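(* For every sequence $x\in\{0,1\}^{\mathbb{N}}$ the limit $E_k(x)=\lim_{n\to\infty}\frac1n\max\{K(u):u\in\mathrm{Fac}_n(x)\}$ exists and equals the topological entropy $E_t(x)=\lim_{n\to\infty}\frac1n\log_2 p_x(n)$.
   Context: $\mathrm{Fac}_n(x)$ is the set of words of length $n$ occurring in $x$, and $p_x(n)=\#\mathrm{Fac}_n(x)$ is the subword complexity; the limit defining $E_t(x)$ always exists. $K(u)$ is the (plain) Kolmogorov complexity of a binary word $u$: the length of a shortest binary description of $u$ with respect to a fixed optimal universal decompressor (defined up to an additive constant). *)

theory Defs
  imports Complex_Main "HOL-Library.Extended_Nat"
begin

section \<open>Partial recursive functions\<close>

datatype recf =
    Zero
  | Succ
  | Proj nat
  | Comp recf "recf list"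
  | Prec recf recf
  | Mu recf

text \<open>
  \<open>computes r xs y\<close>: the value of \<open>r\<close> at \<open>xs\<close> is defined and equal to \<open>y\<close>. Arities are not
  tracked in the syntax: restricted to argument lists of any fixed length \<open>k\<close>, a term denotes a
  \<open>k\<close>-ary partial recursive function (nowhere defined where the arities do not fit together).
  Composition is strict, and minimization requires all earlier values to be defined.
\<close>

inductive computes :: "recf \<Rightarrow> nat list \<Rightarrow> nat \<Rightarrow> bool" where
  zero: "computes Zero xs 0"
| succ: "computes Succ [x] (Suc x)"
| proj: "i < length xs \<Longrightarrow> computes (Proj i) xs (xs ! i)"
| comp: "list_all2 (\<lambda>g y. computes g xs y) gs ys \<Longrightarrow> computes f ys z \<Longrightarrow>
    computes (Comp f gs) xs z"
| prec_0: "computes f xs y \<Longrightarrow> computes (Prec f g) (0 # xs) y"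
| prec_Suc: "computes (Prec f g) (n # xs) y \<Longrightarrow> computes g (n # y # xs) z \<Longrightarrow>
    computes (Prec f g) (Suc n # xs) z"
| mu: "computes f (n # xs) 0 \<Longrightarrow> (\<And>i. i < n \<Longrightarrow> \<exists>y>0. computes f (i # xs) y) \<Longrightarrow>
    computes (Mu f) xs n"

inductive_cases computes_ZeroE: "computes Zero xs y"
inductive_cases computes_SuccE: "computes Succ xs y"
inductive_cases computes_ProjE: "computes (Proj i) xs y"
inductive_cases computes_CompE: "computes (Comp f gs) xs y"
inductive_cases computes_Prec_0E: "computes (Prec f g) (0 # xs) y"
inductive_cases computes_Prec_SucE: "computes (Prec f g) (Suc n # xs) y"
inductive_cases computes_MuE: "computes (Mu f) xs y"

lemma computes_deterministic: "computes r xs y \<Longrightarrow> computes r xs z \<Longrightarrow> y = z"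
proof (induction arbitrary: z rule: computes.induct)
  case (comp xs gs ys f y)
  from comp.prems obtain ys' where ys': "list_all2 (\<lambda>g v. computes g xs v) gs ys'"
    and f: "computes f ys' z"
    by (auto elim: computes_CompE)
  have "ys = ys'"
    using comp.IH(1) ys' by (auto simp: list_all2_conv_all_nth intro!: nth_equalityI)
  with f comp.IH(2) show ?case by simp
next
  case (mu f n xs)
  from mu.prems have z: "computes f (z # xs) 0"
    and below: "\<And>i. i < z \<Longrightarrow> \<exists>y>0. computes f (i # xs) y"
    by (auto elim: computes_MuE)
  have "\<not> z < n" using mu.IH(2) z by fastforce
  moreover have "\<not> n < z" using mu.IH(1) below by fastforce
  ultimately show ?case by simp
next
  case (prec_Suc f g n xs y v)
  from prec_Suc.prems obtain y' where "computes (Prec f g) (n # xs) y'"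
    and g: "computes g (n # y' # xs) z"
    by (rule computes_Prec_SucE)
  with prec_Suc.IH(1) have "y = y'" by blast
  with g prec_Suc.IH(2) show ?case by blast
next
  case (prec_0 f xs y g)
  then show ?case by (blast elim: computes_Prec_0E)
qed (blast elim: computes_ZeroE computes_SuccE computes_ProjE)+


section \<open>Kolmogorov complexity\<close>

type_synonym word = "bool list"

text \<open>Bijective base-2 numeration of binary words, least significant digit first.\<close>

fun word_code :: "word \<Rightarrow> nat" where
  "word_code [] = 0"
| "word_code (b # u) = 2 * word_code u + (if b then 2 else 1)"

lemma bij_word_code: "bij word_code"
proof (rule bijI)
  show "inj word_code"
  proof (rule injI)
    fix u v show "word_code u = word_code v \<Longrightarrow> u = v"
    proof (induction u arbitrary: v)
      case Nil
      then show ?case by (cases v) (auto split: if_splits)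
    next
      case (Cons b u)
      then obtain c w where v: "v = c # w" by (cases v) (auto split: if_splits)
      with Cons.prems have "b = c \<and> word_code u = word_code w"
        by (auto split: if_splits; presburger)
      with Cons.IH v show ?case by blast
    qed
  qed
  have "\<exists>u. word_code u = n" for n
  proof (induction n rule: less_induct)
    case (less n)
    show ?case
    proof (cases "n = 0")
      case True
      then show ?thesis by (intro exI[of _ "[]"]) simp
    next
      case False
      then obtain u where u: "word_code u = (n - 1) div 2"
        using less.IH[of "(n - 1) div 2"] by (metis div_less_dividend diff_less
            div_le_dividend gr0I le_less_trans zero_less_one)
      have "word_code (even n # u) = n"
        using False u by (simp, presburger)
      then show ?thesis by blast
    qed
  qed
  then show "surj word_code" by (metis surjI)
qed

definition partial_computable :: "(word \<rightharpoonup> word) \<Rightarrow> bool" where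
  "partial_computable D \<longleftrightarrow>
     (\<exists>r. \<forall>p u. D p = Some u \<longleftrightarrow> computes r [word_code p] (word_code u))"

text \<open>The infimum is \<open>\<infinity>\<close> if \<open>u\<close> has no description.\<close>

definition complexity :: "(word \<rightharpoonup> word) \<Rightarrow> word \<Rightarrow> enat" where
  "complexity D u = (INF p\<in>{p. D p = Some u}. enat (length p))"

definition optimal_decompressor :: "(word \<rightharpoonup> word) \<Rightarrow> bool" where
  "optimal_decompressor D \<longleftrightarrow> partial_computable D \<and>
     (\<forall>D'. partial_computable D' \<longrightarrow>
        (\<exists>c::nat. \<forall>u. complexity D u \<le> complexity D' u + enat c))"

lemma partial_computable_Some: "partial_computable Some"
  unfolding partial_computable_def
proof (intro exI allI)
  fix p u
  have id: "computes (Proj 0) [n] m \<longleftrightarrow> n = m" for n m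
    using proj[of 0 "[n]"] by (auto elim: computes_ProjE)
  show "Some p = Some u \<longleftrightarrow> computes (Proj 0) [word_code p] (word_code u)"
    using bij_word_code by (simp add: id bij_def inj_eq)
qed

lemma complexity_finite:
  assumes "optimal_decompressor D"
  shows "complexity D u \<noteq> \<infinity>"
proof -
  from assms partial_computable_Some obtain c :: nat where
    "complexity D u \<le> complexity Some u + enat c"
    unfolding optimal_decompressor_def by blast
  then show ?thesis by (cases "complexity D u") (auto simp: complexity_def[of Some])
qed


section \<open>Factors and entropies\<close>

definition Fac :: "(nat \<Rightarrow> bool) \<Rightarrow> nat \<Rightarrow> word set" where
  "Fac x n = {map x [i..<i + n] | i. True}"

lemma finite_Fac: "finite (Fac x n)"
  by (rule finite_subset[OF _ finite_lists_length_eq[of "UNIV :: bool set" n]])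
    (auto simp: Fac_def)

lemma Fac_nonempty: "Fac x n \<noteq> {}"
  by (auto simp: Fac_def)

definition subword_complexity :: "(nat \<Rightarrow> bool) \<Rightarrow> nat \<Rightarrow> nat" where
  "subword_complexity x n = card (Fac x n)"

definition topological_entropy :: "(nat \<Rightarrow> bool) \<Rightarrow> real" where
  "topological_entropy x = lim (\<lambda>n. log 2 (real (subword_complexity x n)) / real n)"

text \<open>
  The conversion from \<^typ>\<open>enat\<close> loses nothing when \<open>D\<close> is optimal, by \<open>complexity_finite\<close>.
\<close>

definition max_complexity :: "(word \<rightharpoonup> word) \<Rightarrow> (nat \<Rightarrow> bool) \<Rightarrow> nat \<Rightarrow> nat" where
  "max_complexity D x n = the_enat (Max (complexity D ` Fac x n))"

definition complexity_entropy :: "(word \<rightharpoonup> word) \<Rightarrow> (nat \<Rightarrow> bool) \<Rightarrow> real" where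
  "complexity_entropy D x = lim (\<lambda>n. real (max_complexity D x n) / real n)"

lemma subword_complexity_pos: "0 < subword_complexity x n"
  by (simp add: subword_complexity_def card_gt_0_iff finite_Fac Fac_nonempty)

lemma subword_complexity_0: "subword_complexity x 0 = 1"
  by (simp add: subword_complexity_def Fac_def)

lemma subword_complexity_add_le:
  "subword_complexity x (m + n) \<le> subword_complexity x m * subword_complexity x n"
proof -
  have "inj_on (\<lambda>w. (take m w, drop m w)) (Fac x (m + n))"
    by (rule inj_onI) (metis append_take_drop_id prod.inject)
  moreover have "(\<lambda>w. (take m w, drop m w)) ` Fac x (m + n) \<subseteq> Fac x m \<times> Fac x n"
  proof clarsimp
    fix w assume "w \<in> Fac x (m + n)"
    then obtain i where w: "w = map x [i..<i + (m + n)]" by (auto simp: Fac_def)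
    have "take m w = map x [i..<i + m]" "drop m w = map x [i + m..<i + m + n]"
      by (auto simp: w take_map drop_map add.assoc)
    then show "take m w \<in> Fac x m \<and> drop m w \<in> Fac x n"
      unfolding Fac_def by blast
  qed
  ultimately have "card (Fac x (m + n)) \<le> card (Fac x m \<times> Fac x n)"
    by (intro card_inj_on_le) (auto simp: finite_Fac)
  then show ?thesis by (simp add: subword_complexity_def card_cartesian_product)
qed

lemma fekete:
  fixes a :: "nat \<Rightarrow> real"
  assumes sub: "\<And>m n. a (m + n) \<le> a m + a n" and nonneg: "\<And>n. 0 \<le> a n" and zero: "a 0 = 0"
  shows "convergent (\<lambda>n. a n / real n)"
proof -
  define L where "L = (INF n\<in>{1..}. a n / real n)"
  have bdd: "bdd_below ((\<lambda>n. a n / real n) ` {1..})"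
    by (rule bdd_belowI[of _ 0]) (auto simp: nonneg)
  have lower: "L \<le> a n / real n" if "n \<ge> 1" for n
    unfolding L_def using that by (intro cINF_lower[OF bdd]) auto
  have mult: "a (k * m) \<le> real k * a m" for k m
  proof (induction k)
    case 0
    then show ?case by (simp add: zero)
  next
    case (Suc k)
    then show ?case using sub[of m "k * m"] by (simp add: algebra_simps)
  qed
  have "(\<lambda>n. a n / real n) \<longlonglongrightarrow> L"
  proof (rule LIMSEQ_I)
    fix e :: real assume e: "e > 0"
    have "\<exists>m\<in>{1..}. a m / real m < L + e / 2"
      using cINF_less_iff[of "{1..}" "\<lambda>n. a n / real n" "L + e / 2"] bdd e
      by (auto simp: L_def)
    then obtain m where m: "m \<ge> 1" "a m / real m < L + e / 2" by auto
    define C where "C = real m * a 1"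
    have C: "C \<ge> 0" by (simp add: C_def nonneg)
    obtain N :: nat where N: "real N > 2 * C / e" using reals_Archimedean2 by blast
    show "\<exists>no. \<forall>n\<ge>no. norm (a n / real n - L) < e"
    proof (intro exI allI impI)
      fix n assume n: "n \<ge> max 1 N"
      have "a n \<le> a (n div m * m) + a (n mod m)"
        using sub[of "n div m * m" "n mod m"] by simp
      also have "\<dots> \<le> real (n div m) * a m + real (n mod m) * a 1"
        using mult[of "n div m" m] mult[of "n mod m" 1] by simp
      also have "\<dots> \<le> (real n / real m) * a m + C"
      proof (intro add_mono mult_right_mono)
        show "real (n div m) \<le> real n / real m" by (rule of_nat_div_le_of_nat)
        show "real (n mod m) * a 1 \<le> C"
          unfolding C_def using m by (intro mult_right_mono) (auto simp: nonneg)
      qed (auto simp: nonneg)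
      finally have "a n / real n \<le> ((real n / real m) * a m + C) / real n"
        by (rule divide_right_mono) simp
      also have "\<dots> = a m / real m + C / real n"
        using n m by (simp add: field_simps)
      finally have "a n / real n \<le> a m / real m + C / real n" .
      moreover have "C / real n < e / 2"
      proof -
        have "2 * C / e < real n" using N n by (meson less_le_trans max.boundedE of_nat_le_iff)
        then show ?thesis using e n by (simp add: field_simps)
      qed
      ultimately have "a n / real n < L + e" using m(2) by linarith
      moreover have "L \<le> a n / real n" using lower n by simp
      ultimately show "norm (a n / real n - L) < e" by simp
    qed
  qed
  then show ?thesis by (rule convergentI)
qed

lemma convergent_topological_entropy:
  "convergent (\<lambda>n. log 2 (real (subword_complexity x n)) / real n)"
proof (rule fekete)
  fix m n
  have pos: "0 < real (subword_complexity x k)" for k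
    using subword_complexity_pos by simp
  have "real (subword_complexity x (m + n))
      \<le> real (subword_complexity x m) * real (subword_complexity x n)"
    using subword_complexity_add_le by (metis of_nat_le_iff of_nat_mult)
  then show "log 2 (real (subword_complexity x (m + n)))
      \<le> log 2 (real (subword_complexity x m)) + log 2 (real (subword_complexity x n))"
    using pos by (metis log_le_cancel_iff log_mult_pos mult_pos_pos one_less_numeral_iff
        semiring_norm(76))
next
  fix n
  show "0 \<le> log 2 (real (subword_complexity x n))"
    using subword_complexity_pos[of x n] by (intro zero_le_log_cancel_iff[THEN iffD2]) auto
qed (simp add: subword_complexity_0)

end

theory Submission
  imports Defs
begin

text \<open>
  Counting descriptions gives \<open>log\<^sub>2 p\<^sub>x(n) - 1 \<le> max K\<close>. Conversely, fix \<open>m\<close> and cut a factor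
  of length \<open>n\<close> into a prefix of length \<open>n mod m\<close> and \<open>n div m\<close> blocks from \<open>Fac\<^sub>m(x)\<close>. Numbering the
  blocks from \<open>1\<close> to \<open>p\<^sub>x(m)\<close>, the sequence of blocks becomes a number in base \<open>p\<^sub>x(m) + 1\<close>, and
  turning it back into a word is a base conversion through a finite table, which is computable.
  Since there are finitely many prefixes, \<open>max K \<le> (n/m) log\<^sub>2 (p\<^sub>x(m) + 1) + c\<^sub>m\<close>; now let
  \<open>n\<close> and then \<open>m\<close> tend to infinity.
\<close>

section \<open>Total recursive functions\<close>

text \<open>The term is hidden behind an existential, so recursiveness is proved by closure rules on
  HOL functions without writing terms down. Values on lists of other lengths are ignored.\<close>

definition total_recursive :: "nat \<Rightarrow> (nat list \<Rightarrow> nat) \<Rightarrow> bool" where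
  "total_recursive k f \<longleftrightarrow> (\<exists>r. \<forall>xs. length xs = k \<longrightarrow> computes r xs (f xs))"

section \<open>Closure under composition and primitive recursion\<close>

lemma total_recursive_cong:
  "total_recursive k f \<Longrightarrow> (\<And>xs. length xs = k \<Longrightarrow> f xs = g xs) \<Longrightarrow> total_recursive k g"
  unfolding total_recursive_def by metis

lemma total_recursive_nth: "i < k \<Longrightarrow> total_recursive k (\<lambda>xs. xs ! i)"
  unfolding total_recursive_def using computes.proj by blast

lemma total_recursive_comp:
  assumes "total_recursive (length gs) f" and "\<And>g. g \<in> set gs \<Longrightarrow> total_recursive k g"
  shows "total_recursive k (\<lambda>xs. f (map (\<lambda>g. g xs) gs))"
proof -
  obtain r where r: "\<And>ys. length ys = length gs \<Longrightarrow> computes r ys (f ys)"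
    using assms(1) unfolding total_recursive_def by blast
  obtain R where R: "\<And>g xs. g \<in> set gs \<Longrightarrow> length xs = k \<Longrightarrow> computes (R g) xs (g xs)"
    using assms(2) unfolding total_recursive_def by metis
  have "computes (Comp r (map R gs)) xs (f (map (\<lambda>g. g xs) gs))" if "length xs = k" for xs
    using that R
    by (intro computes.comp[where ys = "map (\<lambda>g. g xs) gs"] r)
      (auto simp: list_all2_map1 list_all2_map2 intro!: list.rel_refl_strong)
  then show ?thesis unfolding total_recursive_def by blast
qed

text \<open>Together with its binary companion, this allows each operation below to be treated on
  projections and then applied to arbitrary recursive subexpressions.\<close>

lemma total_recursive_comp1:
  assumes "total_recursive 1 (\<lambda>xs. f (xs ! 0))" and "total_recursive k g"
  shows "total_recursive k (\<lambda>xs. f (g xs))"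
  using total_recursive_comp[of "[g]" "\<lambda>xs. f (xs ! 0)" k] assms by simp

lemma total_recursive_comp2:
  assumes "total_recursive 2 (\<lambda>xs. f (xs ! 0) (xs ! 1))"
    and "total_recursive k g" and "total_recursive k h"
  shows "total_recursive k (\<lambda>xs. f (g xs) (h xs))"
  using total_recursive_comp[of "[g, h]" "\<lambda>xs. f (xs ! 0) (xs ! 1)" k] assms
  by (auto simp: numeral_2_eq_2)

lemma total_recursive_Suc:
  assumes "total_recursive k f"
  shows "total_recursive k (\<lambda>xs. Suc (f xs))"
proof (rule total_recursive_comp1[OF _ assms])
  have "computes Succ xs (Suc (xs ! 0))" if "length xs = 1" for xs
    using that computes.succ by (cases xs) auto
  then show "total_recursive 1 (\<lambda>xs. Suc (xs ! 0))"
    unfolding total_recursive_def by blast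
qed

lemma total_recursive_const: "total_recursive k (\<lambda>_. c)"
proof (induction c)
  case 0
  show ?case unfolding total_recursive_def using computes.zero by blast
qed (rule total_recursive_Suc)

lemma total_recursive_rec_nat:
  assumes "total_recursive k f" and "total_recursive (k + 2) g"
  shows "total_recursive (Suc k)
    (\<lambda>xs. rec_nat (f (tl xs)) (\<lambda>n y. g (n # y # tl xs)) (xs ! 0))"
proof -
  obtain r s where r: "\<And>xs. length xs = k \<Longrightarrow> computes r xs (f xs)"
    and s: "\<And>xs. length xs = k + 2 \<Longrightarrow> computes s xs (g xs)"
    using assms unfolding total_recursive_def by blast
  have "computes (Prec r s) (n # xs) (rec_nat (f xs) (\<lambda>n y. g (n # y # xs)) n)"
    if "length xs = k" for n xs
    by (induction n) (use that r s in \<open>auto intro: computes.prec_0 computes.prec_Suc\<close>)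
  then have "computes (Prec r s) xs (rec_nat (f (tl xs)) (\<lambda>n y. g (n # y # tl xs)) (xs ! 0))"
    if "length xs = Suc k" for xs
    using that by (cases xs) auto
  then show ?thesis unfolding total_recursive_def by blast
qed

section \<open>Arithmetic and finite tables\<close>

lemma total_recursive_add:
  assumes "total_recursive k f" and "total_recursive k g"
  shows "total_recursive k (\<lambda>xs. f xs + g xs)"
proof (rule total_recursive_comp2[OF _ assms])
  \<comment> \<open>The recursion step is written as a function of the whole list
    \<open>n # y # tl xs\<close>, the form to which \<open>total_recursive_rec_nat\<close>
    applies.\<close>
  have "total_recursive (Suc 1)
    (\<lambda>xs. rec_nat (tl xs ! 0) (\<lambda>n y. Suc ((n # y # tl xs) ! 1)) (xs ! 0))"
    by (intro total_recursive_rec_nat total_recursive_Suc total_recursive_nth) auto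
  moreover have "rec_nat b (\<lambda>n y. Suc y) a = a + b" for a b :: nat
    by (induction a) auto
  ultimately show "total_recursive 2 (\<lambda>xs. xs ! 0 + xs ! 1)"
    by (auto simp: numeral_2_eq_2 nth_tl elim: total_recursive_cong)
qed

lemma total_recursive_mult:
  assumes "total_recursive k f" and "total_recursive k g"
  shows "total_recursive k (\<lambda>xs. f xs * g xs)"
proof (rule total_recursive_comp2[OF _ assms])
  have "total_recursive (Suc 1)
    (\<lambda>xs. rec_nat 0 (\<lambda>n y. (n # y # tl xs) ! 1 + (n # y # tl xs) ! 2) (xs ! 0))"
    by (intro total_recursive_rec_nat total_recursive_add total_recursive_nth
        total_recursive_const) auto
  moreover have "rec_nat 0 (\<lambda>n y. y + b) a = a * b" for a b :: nat
    by (induction a) auto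
  ultimately show "total_recursive 2 (\<lambda>xs. xs ! 0 * xs ! 1)"
    by (auto simp: numeral_2_eq_2 nth_tl elim: total_recursive_cong)
qed

lemma total_recursive_power:
  assumes "total_recursive k f"
  shows "total_recursive k (\<lambda>xs. b ^ f xs)"
proof (rule total_recursive_comp1[OF _ assms])
  have "total_recursive (Suc 0) (\<lambda>xs. rec_nat 1 (\<lambda>n y. b * (n # y # tl xs) ! 1) (xs ! 0))"
    by (intro total_recursive_rec_nat total_recursive_mult total_recursive_nth
        total_recursive_const) auto
  moreover have "rec_nat 1 (\<lambda>n y. b * y) a = b ^ a" for a
    by (induction a) auto
  ultimately show "total_recursive 1 (\<lambda>xs. b ^ (xs ! 0))"
    by simp
qed

text \<open>Induction on the support bound: \<open>t\<close> is its value at 0 together with a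
  shifted table, and a primitive recursion ignoring its accumulator makes this case split. The
  entries may come from any source, computable or not, since only finitely many are wired
  in.\<close>

lemma total_recursive_table:
  assumes "\<And>n. N \<le> n \<Longrightarrow> t n = (0::nat)" and "total_recursive k f"
  shows "total_recursive k (\<lambda>xs. t (f xs))"
proof (rule total_recursive_comp1[OF _ assms(2)])
  show "total_recursive 1 (\<lambda>xs. t (xs ! 0))"
    using assms(1)
  proof (induction N arbitrary: t)
    case 0
    then show ?case by (simp add: total_recursive_const)
  next
    case (Suc N)
    have "total_recursive 1 (\<lambda>xs. t (Suc (xs ! 0)))"
      by (rule Suc.IH) (simp add: Suc.prems)
    then have "total_recursive (0 + 2) (\<lambda>xs. t (Suc (xs ! 0)))"
      by (rule total_recursive_comp1) (auto intro: total_recursive_nth)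
    from total_recursive_rec_nat[OF total_recursive_const[of _ "t 0"] this]
    have "total_recursive 1
      (\<lambda>xs. rec_nat (t 0) (\<lambda>n y. t (Suc ((n # y # tl xs) ! 0))) (xs ! 0))"
      by simp
    moreover have "rec_nat (t 0) (\<lambda>n y. t (Suc n)) a = t a" for a
      by (cases a) auto
    ultimately show ?case by simp
  qed
qed

lemma total_recursive_mod:
  assumes "total_recursive k f" and "K > 0"
  shows "total_recursive k (\<lambda>xs. f xs mod K)"
proof (rule total_recursive_comp1[OF _ assms(1)])
  \<comment> \<open>Successor modulo \<open>K\<close> on the residues, set to 0 from
    \<open>K - 1\<close> on so that it is a finite table; iterating it from 0 counts modulo
    \<open>K\<close>.\<close>
  define t where "t r = (if Suc r < K then Suc r else 0)" for r
  have "total_recursive (Suc 0) (\<lambda>xs. rec_nat 0 (\<lambda>n y. t ((n # y # tl xs) ! 1)) (xs ! 0))"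
    by (intro total_recursive_rec_nat total_recursive_table[where t = t and N = K] total_recursive_nth
        total_recursive_const) (auto simp: t_def)
  moreover have "rec_nat 0 (\<lambda>n y. t y) a = a mod K" for a
  proof (induction a)
    case (Suc a)
    have "a mod K < K" using assms(2) by simp
    with Suc show ?case by (auto simp: t_def mod_Suc)
  qed simp
  ultimately show "total_recursive 1 (\<lambda>xs. xs ! 0 mod K)" by simp
qed

lemma total_recursive_div:
  assumes "total_recursive k f" and "K > 0"
  shows "total_recursive k (\<lambda>xs. f xs div K)"
proof (rule total_recursive_comp1[OF _ assms(1)])
  \<comment> \<open>Marks the residue \<open>K - 1\<close>, at which passing from \<open>n\<close>
    to \<open>n + 1\<close> increases the quotient.\<close>
  define t where "t r = (if Suc r = K then 1 else 0 :: nat)" for r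
  have "total_recursive (0 + 2) (\<lambda>ys. ys ! 1 + t (ys ! 0 mod K))"
    by (intro total_recursive_add total_recursive_table[where t = t and N = K]
        total_recursive_mod total_recursive_nth assms(2)) (auto simp: t_def)
  from total_recursive_rec_nat[OF total_recursive_const[of _ 0] this]
  have "total_recursive 1 (\<lambda>xs. rec_nat 0 (\<lambda>n y. y + t (n mod K)) (xs ! 0))"
    by simp
  moreover have "rec_nat 0 (\<lambda>n y. y + t (n mod K)) a = a div K" for a
    by (induction a) (auto simp: t_def div_Suc mod_Suc)
  ultimately show "total_recursive 1 (\<lambda>xs. xs ! 0 div K)" by simp
qed

lemma total_recursive_div_power:
  assumes "total_recursive k f" and "total_recursive k g" and "K > 0"
  shows "total_recursive k (\<lambda>xs. f xs div K ^ g xs)"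
proof (rule total_recursive_comp2[OF _ assms(1,2)])
  have "total_recursive (1 + 2) (\<lambda>ys. ys ! 1 div K)"
    by (rule total_recursive_div[OF total_recursive_nth assms(3)]) simp
  from total_recursive_rec_nat[OF total_recursive_nth[of 0] this]
  have "total_recursive 2 (\<lambda>xs. rec_nat (tl xs ! 0) (\<lambda>n y. y div K) (xs ! 0))"
    by (simp add: numeral_2_eq_2)
  moreover have "rec_nat b (\<lambda>n y. y div K) a = b div K ^ a" for a b
    by (induction a) (auto simp: div_mult2_eq[symmetric] mult.commute)
  ultimately have "total_recursive 2 (\<lambda>xs. xs ! 1 div K ^ (xs ! 0))"
    by (auto simp: numeral_2_eq_2 nth_tl elim: total_recursive_cong)
  \<comment> \<open>The recursion counter had to come first; composing with projections exchanges
    the two arguments.\<close>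
  then show "total_recursive 2 (\<lambda>xs. xs ! 0 div K ^ (xs ! 1))"
    by (rule total_recursive_comp2) (auto intro: total_recursive_nth)
qed


section \<open>Base conversion\<close>

text \<open>The bound of the sum only has to exceed the number of digits of \<open>N\<close>.\<close>

definition convert_base :: "nat \<Rightarrow> nat \<Rightarrow> (nat \<Rightarrow> nat) \<Rightarrow> nat \<Rightarrow> nat" where
  "convert_base K M t N = (\<Sum>j<N. t (N div K ^ j mod K) * M ^ j)"

text \<open>For \<open>j \<ge> N\<close> one has \<open>N < K ^ j\<close>, so the digit is 0 and
  \<open>t 0 = 0\<close> removes the term. Sums for different numbers can thus be brought to a
  common range.\<close>

lemma convert_base_extend:
  assumes "K \<ge> 2" and "t 0 = 0" and "N \<le> L"
  shows "convert_base K M t N = (\<Sum>j<L. t (N div K ^ j mod K) * M ^ j)"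
  unfolding convert_base_def
proof (rule sum.mono_neutral_left)
  have "N < K ^ j" if "N \<le> j" for j
  proof -
    have "j < 2 ^ j" by simp
    also have "\<dots> \<le> K ^ j" using assms(1) by (rule power_mono) simp
    finally show ?thesis using that by simp
  qed
  then show "\<forall>j\<in>{..<L} - {..<N}. t (N div K ^ j mod K) * M ^ j = 0"
    using assms(2) by simp
qed (use assms in auto)

lemma convert_base_0: "convert_base K M t 0 = 0"
  by (simp add: convert_base_def)

text \<open>A Horner step: \<open>d\<close> is the lowest digit of the argument, and the digits of
  \<open>N\<close> follow, shifted by one place. The values of \<open>t\<close> can exceed
  \<open>M\<close>, just as codes of blocks of length \<open>m\<close> can exceed
  \<open>2 ^ m\<close>.\<close>

lemma convert_base_digit:
  assumes "K \<ge> 2" and "t 0 = 0" and "d < K"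
  shows "convert_base K M t (d + K * N) = t d + M * convert_base K M t N"
proof -
  let ?L = "d + K * N"
  have "N \<le> ?L" using assms(1) by (simp add: trans_le_add2)
  \<comment> \<open>One summand more than \<open>?L\<close>, so that splitting off
    \<open>j = 0\<close> leaves a sum over \<open>j < ?L\<close>, a range long enough for
    \<open>N\<close> as well.\<close>
  have "convert_base K M t ?L = (\<Sum>j<Suc ?L. t (?L div K ^ j mod K) * M ^ j)"
    using assms by (intro convert_base_extend) auto
  also have "\<dots> = t d + (\<Sum>j<?L. t (?L div K ^ Suc j mod K) * M ^ Suc j)"
    unfolding sum.lessThan_Suc_shift using assms(3) by simp
  also have "(\<Sum>j<?L. t (?L div K ^ Suc j mod K) * M ^ Suc j) = M * convert_base K M t N"
  proof -
    have "?L div K ^ Suc j = N div K ^ j" for j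
      using assms by (simp add: div_mult2_eq)
    then show ?thesis
      unfolding convert_base_extend[where t = t, OF assms(1,2) \<open>N \<le> ?L\<close>] sum_distrib_left
      by (intro sum.cong) auto
  qed
  finally show ?thesis .
qed

text \<open>The sum is built by primitive recursion on its number of terms, kept as an argument
  separate from the number being converted; the two are identified only at the end.\<close>

lemma total_recursive_convert_base:
  assumes "K > 0" and "\<And>d. K \<le> d \<Longrightarrow> t d = 0" and "total_recursive k f"
  shows "total_recursive k (\<lambda>xs. convert_base K M t (f xs))"
proof (rule total_recursive_comp1[OF _ assms(3)])
  have "total_recursive (1 + 2)
    (\<lambda>ys. ys ! 1 + t (ys ! 2 div K ^ (ys ! 0) mod K) * M ^ (ys ! 0))"
    by (intro total_recursive_add total_recursive_mult total_recursive_power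
        total_recursive_table[where t = t and N = K] total_recursive_mod
        total_recursive_div_power total_recursive_nth assms(1,2)) auto
  from total_recursive_rec_nat[OF total_recursive_const[of _ 0] this]
  have "total_recursive 2 (\<lambda>xs. rec_nat 0 (\<lambda>n y. y +
      t (tl xs ! 0 div K ^ n mod K) * M ^ n) (xs ! 0))"
    by (simp add: numeral_2_eq_2)
  moreover have "rec_nat 0 (\<lambda>n y. y + t (N div K ^ n mod K) * M ^ n) a =
      (\<Sum>j<a. t (N div K ^ j mod K) * M ^ j)" for N a
    by (induction a) auto
  ultimately have "total_recursive 2
      (\<lambda>xs. \<Sum>j<xs ! 0. t (xs ! 1 div K ^ j mod K) * M ^ j)"
    by (auto simp: numeral_2_eq_2 nth_tl elim: total_recursive_cong)
  then show "total_recursive 1 (\<lambda>xs. convert_base K M t (xs ! 0))"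
    unfolding convert_base_def
    by (rule total_recursive_comp2) (auto intro: total_recursive_nth)
qed


section \<open>Upper bound\<close>

text \<open>Bijective numeration with digits 1 and 2 is still positional: prefixing \<open>u\<close>
  shifts the code of \<open>v\<close> by \<open>length u\<close> places. Concatenating blocks of
  length \<open>m\<close> thus becomes a sum in powers of \<open>2 ^ m\<close>.\<close>

lemma word_code_append: "word_code (u @ v) = word_code u + 2 ^ length u * word_code v"
  by (induction u) (auto simp: algebra_simps)

text \<open>The extreme case is a word all of whose letters are \<open>False\<close>. Read as a
  bound on the length, this makes the program with code \<open>N\<close> at most
  \<open>log 2 (N + 1)\<close> long.\<close>

lemma power_length_le_word_code: "2 ^ length u \<le> Suc (word_code u)"
  by (induction u) auto

lemma word_code_less: "word_code u < 2 ^ Suc (length u)"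
proof -
  \<comment> \<open>The sharp bound, attained by words consisting of \<open>True\<close>; unlike the
    weaker one, it is preserved by the induction step.\<close>
  have "word_code u + 2 \<le> 2 ^ Suc (length u)" by (induction u) auto
  then show ?thesis by linarith
qed

section \<open>Descriptions of concatenated blocks\<close>

lemma complexity_le: "D p = Some u \<Longrightarrow> complexity D u \<le> enat (length p)"
  unfolding complexity_def by (rule INF_lower) simp

text \<open>Sending the program with code \<open>N\<close> to the word with code \<open>f N\<close>
  is a decompressor, and passing to the optimal one costs a constant \<open>c\<close>. Bounding
  \<open>2 ^ l\<close> keeps the later counting in the natural numbers.\<close>

lemma complexity_le_total_recursive:
  assumes "optimal_decompressor D" and "total_recursive 1 (\<lambda>xs. f (xs ! 0))"
  shows "\<exists>c. \<forall>N u. f N = word_code u \<longrightarrow>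
    (\<exists>l. complexity D u \<le> enat l \<and> 2 ^ l \<le> 2 ^ c * Suc N)"
proof -
  obtain r where r': "\<And>xs. length xs = 1 \<Longrightarrow> computes r xs (f (xs ! 0))"
    using assms(2) unfolding total_recursive_def by blast
  have r: "computes r [a] (f a)" for a using r'[of "[a]"] by simp
  define D' where "D' p = Some (inv word_code (f (word_code p)))" for p
  have "D' p = Some u \<longleftrightarrow> computes r [word_code p] (word_code u)" for p u
  proof -
    have "D' p = Some u \<longleftrightarrow> f (word_code p) = word_code u"
      unfolding D'_def using bij_word_code
      by (metis bij_inv_eq_iff option.inject)
    then show ?thesis using r computes_deterministic by metis
  qed
  then have "partial_computable D'" unfolding partial_computable_def by blast
  then obtain c :: nat where c: "\<And>u. complexity D u \<le> complexity D' u + enat c"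
    using assms(1) unfolding optimal_decompressor_def by blast
  have "\<exists>l. complexity D u \<le> enat l \<and> 2 ^ l \<le> 2 ^ c * Suc N" if "f N = word_code u" for N u
  proof (intro exI conjI)
    define p where "p = inv word_code N"
    have p: "word_code p = N"
      unfolding p_def using bij_word_code by (simp add: bij_def surj_f_inv_f)
    have "D' p = Some u"
      unfolding D'_def p using that bij_word_code by (simp add: bij_def inv_f_f)
    then have "complexity D' u \<le> enat (length p)" by (rule complexity_le)
    then have "complexity D' u + enat c \<le> enat (length p) + enat c" by (rule add_right_mono)
    with c show "complexity D u \<le> enat (length p + c)"
      by (metis order_trans plus_enat_simps(1))
    show "2 ^ (length p + c) \<le> 2 ^ c * Suc N"
      using mult_le_mono2[OF power_length_le_word_code[of p], of "2 ^ c"]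
      by (simp only: p power_add mult.commute)
  qed
  then show ?thesis by blast
qed

text \<open>A decompressor with \<open>w\<close> and a table of \<open>B\<close> built in reads the
  blocks off the digits of a number in base \<open>card B + 1\<close>. Hence \<open>c\<close> may
  depend on \<open>w\<close> and \<open>B\<close> but not on \<open>bs\<close>.\<close>

lemma complexity_concat_le:
  assumes "optimal_decompressor D" and "finite B" and "\<And>b. b \<in> B \<Longrightarrow> length b = m"
  shows "\<exists>c. \<forall>bs. set bs \<subseteq> B \<longrightarrow>
    (\<exists>l. complexity D (w @ concat bs) \<le> enat l \<and> 2 ^ l \<le> 2 ^ c * Suc (card B) ^ length bs)"
proof (cases "B = {}")
  case True
  \<comment> \<open>Without blocks \<open>bs\<close> is empty, and the base
    \<open>card B + 1\<close> would be 1, too small for digits.\<close>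
  obtain l where "complexity D w = enat l"
    using complexity_finite[OF assms(1), of w] by (cases "complexity D w") auto
  with True show ?thesis by (intro exI[of _ l]) auto
next
  case False
  define K where "K = Suc (card B)"
  have K: "K \<ge> 2" using False assms(2) by (simp add: K_def Suc_le_eq card_gt_0_iff)
  obtain h where h: "bij_betw h B {0..<card B}"
    using ex_bij_betw_finite_nat[OF assms(2)] by blast
  \<comment> \<open>Blocks are numbered from 1; digit 0 is reserved for the positions past the end
    of the number and must contribute nothing.\<close>
  define t where "t d = (if d \<in> {1..card B} then word_code (inv_into B h (d - 1)) else 0)" for d
  have t: "t (Suc (h b)) = word_code b" "Suc (h b) < K" if "b \<in> B" for b
  proof -
    have "h b < card B" using that h by (auto simp: bij_betw_def)
    moreover have "inv_into B h (h b) = b"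
      using that h by (auto simp: bij_betw_def)
    ultimately show "t (Suc (h b)) = word_code b" "Suc (h b) < K"
      by (auto simp: t_def K_def)
  qed
  define f where "f N = word_code w + 2 ^ length w * convert_base K (2 ^ m) t N" for N
  have "total_recursive 1 (\<lambda>xs. f (xs ! 0))"
    unfolding f_def
    by (intro total_recursive_add total_recursive_mult total_recursive_const
        total_recursive_convert_base total_recursive_nth) (auto simp: K_def t_def)
  from complexity_le_total_recursive[OF assms(1) this]
  obtain c where c: "\<And>N u. f N = word_code u \<Longrightarrow>
      \<exists>l. complexity D u \<le> enat l \<and> 2 ^ l \<le> 2 ^ c * Suc N"
    by blast
  \<comment> \<open>The first block becomes the least significant digit, matching the digit order of
    \<open>word_code\<close>.\<close>
  have encode: "\<exists>N < K ^ length bs. convert_base K (2 ^ m) t N = word_code (concat bs)"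
    if "set bs \<subseteq> B" for bs
    using that
  proof (induction bs)
    case Nil
    then show ?case by (simp add: convert_base_0)
  next
    case (Cons b bs)
    then obtain N where N: "N < K ^ length bs"
      "convert_base K (2 ^ m) t N = word_code (concat bs)" by auto
    from Cons.prems have b: "b \<in> B" by simp
    have "convert_base K (2 ^ m) t (Suc (h b) + K * N) = word_code (concat (b # bs))"
      using N(2) K t[OF b] assms(3)[OF b]
      by (subst convert_base_digit) (auto simp: t_def word_code_append)
    moreover have "Suc (h b) + K * N < K ^ length (b # bs)"
    proof -
      have "Suc (h b) + K * N < K * Suc N" using t(2)[OF b] by simp
      also have "\<dots> \<le> K * K ^ length bs" using N(1) by (intro mult_le_mono2) simp
      finally show ?thesis by simp
    qed
    ultimately show ?case by blast
  qed
  have "\<exists>l. complexity D (w @ concat bs) \<le> enat l \<and> 2 ^ l \<le> 2 ^ c * K ^ length bs"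
    if bs: "set bs \<subseteq> B" for bs
  proof -
    from encode[OF bs] obtain N where N: "N < K ^ length bs"
      "convert_base K (2 ^ m) t N = word_code (concat bs)" by blast
    then have "f N = word_code (w @ concat bs)" by (simp add: f_def word_code_append)
    from c[OF this] obtain l
      where l: "complexity D (w @ concat bs) \<le> enat l" "2 ^ l \<le> 2 ^ c * Suc N"
      by blast
    have "2 ^ c * Suc N \<le> 2 ^ c * K ^ length bs" using N(1) by (intro mult_le_mono2) simp
    with l show ?thesis using order_trans by blast
  qed
  then show ?thesis unfolding K_def by blast
qed

section \<open>Factors and their maximal complexity\<close>

lemma Fac_eq_concat:
  assumes "u \<in> Fac x (r + m * J)"
  shows "\<exists>w bs. u = w @ concat bs \<and> length w = r \<and> length bs = J \<and> set bs \<subseteq> Fac x m"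
proof -
  \<comment> \<open>The start \<open>i\<close> varies in the induction: removing the first window
    moves it to \<open>i + m\<close>.\<close>
  have *: "\<exists>bs. map x [i..<i + m * J] = concat bs \<and> length bs = J \<and> set bs \<subseteq> Fac x m" for i
  proof (induction J arbitrary: i)
    case 0
    then show ?case by simp
  next
    case (Suc J)
    obtain bs where bs: "map x [i + m..<i + m + m * J] = concat bs" "length bs = J"
      "set bs \<subseteq> Fac x m" using Suc by blast
    have "map x [i..<i + m * Suc J] = concat (map x [i..<i + m] # bs)"
      using bs(1) upt_add_eq_append[of i "i + m" "m * J"] by (simp add: add.assoc)
    moreover have "map x [i..<i + m] \<in> Fac x m" by (auto simp: Fac_def)
    ultimately show ?case using bs(2,3)
      by (intro exI[of _ "map x [i..<i + m] # bs"]) simp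
  qed
  from assms obtain i where i: "u = map x [i..<i + (r + m * J)]" by (auto simp: Fac_def)
  obtain bs where bs: "map x [i + r..<i + r + m * J] = concat bs" "length bs = J"
    "set bs \<subseteq> Fac x m" using * by blast
  have "u = map x [i..<i + r] @ concat bs"
    using bs(1) upt_add_eq_append[of i "i + r" "m * J"] by (simp add: i add.assoc)
  with bs(2,3) show ?thesis by (intro exI[of _ "map x [i..<i + r]"] exI[of _ bs]) simp
qed

lemma max_complexity_bounds:
  assumes "optimal_decompressor D"
  shows "\<And>u. u \<in> Fac x n \<Longrightarrow> complexity D u \<le> enat (max_complexity D x n)"
    and "\<exists>u \<in> Fac x n. complexity D u = enat (max_complexity D x n)"
proof -
  let ?S = "complexity D ` Fac x n"
  have fin: "finite ?S" "?S \<noteq> {}" using finite_Fac Fac_nonempty by auto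
  obtain u where u: "u \<in> Fac x n" "complexity D u = Max ?S"
    using Max_in[OF fin] by auto
  \<comment> \<open>The maximum is attained at some factor, so it is finite and \<open>enat\<close>
    inverts \<open>the_enat\<close> on it.\<close>
  have M: "Max ?S = enat (max_complexity D x n)"
    unfolding max_complexity_def
    using complexity_finite[OF assms, of u] u(2) by (cases "Max ?S") auto
  show "\<exists>u \<in> Fac x n. complexity D u = enat (max_complexity D x n)" using u M by metis
  show "complexity D u \<le> enat (max_complexity D x n)" if "u \<in> Fac x n" for u
    using Max_ge[OF fin(1)] that M by (metis imageI)
qed

lemma max_complexity_le:
  assumes "optimal_decompressor D" and "m > 0"
  shows "\<exists>c. \<forall>n. real (max_complexity D x n) \<le>
    real c + real n / real m * (log 2 (real (subword_complexity x m)) + 1)"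
proof -
  let ?p = "subword_complexity x m"
  have "\<exists>c. \<forall>bs. set bs \<subseteq> Fac x m \<longrightarrow>
    (\<exists>l. complexity D (w @ concat bs) \<le> enat l \<and> 2 ^ l \<le> 2 ^ c * Suc ?p ^ length bs)" for w
    unfolding subword_complexity_def
    by (rule complexity_concat_le[OF assms(1) finite_Fac]) (auto simp: Fac_def)
  then obtain c where c: "\<And>w bs. set bs \<subseteq> Fac x m \<Longrightarrow>
      \<exists>l. complexity D (w @ concat bs) \<le> enat l \<and> 2 ^ l \<le> 2 ^ c w * Suc ?p ^ length bs"
    by metis
  \<comment> \<open>The constant \<open>c w\<close> depends on the prefix. Only prefixes of length
    at most \<open>m\<close> occur, and \<open>C\<close> bounds their constants uniformly in
    \<open>n\<close>.\<close>
  let ?W = "{w :: word. set w \<subseteq> UNIV \<and> length w \<le> m}"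
  have W: "finite ?W" by (rule finite_lists_length_le) simp
  define C where "C = Max (c ` ?W)"
  have "real (max_complexity D x n) \<le> real C + real n / real m * (log 2 ?p + 1)" for n
  proof -
    let ?k = "max_complexity D x n" and ?J = "n div m"
    obtain u where u: "u \<in> Fac x n" "complexity D u = enat ?k"
      using max_complexity_bounds(2)[OF assms(1)] by blast
    have "u \<in> Fac x (n mod m + m * ?J)" using u(1) by simp
    then obtain w bs where w: "u = w @ concat bs" "length w = n mod m" "length bs = ?J"
      "set bs \<subseteq> Fac x m" using Fac_eq_concat by blast
    obtain l where l: "enat ?k \<le> enat l" "2 ^ l \<le> 2 ^ c w * Suc ?p ^ ?J"
      using c[OF w(4), of w] w(1,3) u(2) by auto
    have "w \<in> ?W" using w(2) assms(2) by (simp add: less_imp_le)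
    then have "c w \<le> C" unfolding C_def using W by (intro Max_ge) auto
    have p: "?p \<ge> 1" using subword_complexity_pos by (simp add: Suc_le_eq)
    \<comment> \<open>Uses \<open>?p + 1 \<le> 2 * ?p\<close>. Each block then costs
      \<open>log 2 ?p + 1\<close>, and the added 1 ends up divided by \<open>m\<close>, so it
      vanishes as \<open>m\<close> grows.\<close>
    have "2 ^ l \<le> 2 ^ C * (2 * ?p) ^ ?J"
      using p by (intro order_trans[OF l(2)] mult_le_mono power_increasing[OF \<open>c w \<le> C\<close>]
          power_mono) auto
    then have "real (2 ^ l) \<le> real (2 ^ C * (2 * ?p) ^ ?J)" by (rule of_nat_mono)
    then have "log 2 (2 ^ l) \<le> log 2 (2 ^ C * (2 * real ?p) ^ ?J)"
      using p by (subst log_le_cancel_iff) auto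
    also have "\<dots> = real C + real ?J * (log 2 ?p + 1)"
      using p by (simp add: log_mult log_nat_power algebra_simps)
    also have "log 2 (2 ^ l) = real l" by (simp add: log_nat_power)
    finally have "real l \<le> real C + real ?J * (log 2 ?p + 1)" .
    moreover have "real ?J * (log 2 ?p + 1) \<le> real n / real m * (log 2 ?p + 1)"
      using p by (intro mult_right_mono of_nat_div_le_of_nat) auto
    ultimately show ?thesis using l(1) by simp
  qed
  then show ?thesis by blast
qed


section \<open>Lower bound\<close>

text \<open>Distinct factors have distinct descriptions of length at most the maximum
  \<open>k\<close>, and there are fewer than \<open>2 ^ (k + 1)\<close> words of length at most
  \<open>k\<close>; this exponent is the source of the added 1.\<close>

lemma log_subword_complexity_le:
  assumes "optimal_decompressor D"
  shows "log 2 (real (subword_complexity x n)) \<le> real (max_complexity D x n) + 1"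
proof -
  let ?k = "max_complexity D x n"
  have "\<exists>p. D p = Some u \<and> length p \<le> ?k" if "u \<in> Fac x n" for u
  proof -
    \<comment> \<open>Strict inequality against the successor turns the infimum into an actual
      description.\<close>
    have "complexity D u < enat (Suc ?k)"
      using max_complexity_bounds(1)[OF assms that] by (rule order_le_less_trans) simp
    then show ?thesis unfolding complexity_def by (auto simp: INF_less_iff)
  qed
  then obtain d where d: "\<And>u. u \<in> Fac x n \<Longrightarrow> D (d u) = Some u \<and> length (d u) \<le> ?k"
    by metis
  have "card (Fac x n) \<le> card {..<2 ^ Suc ?k :: nat}"
  proof (rule card_inj_on_le)
    show "inj_on (word_code \<circ> d) (Fac x n)"
    proof (rule comp_inj_on)
      show "inj_on d (Fac x n)" by (rule inj_onI) (metis d option.inject)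
      show "inj_on word_code (d ` Fac x n)"
        using bij_word_code by (auto simp: bij_def intro: inj_on_subset)
    qed
    have "word_code (d u) < 2 ^ Suc ?k" if "u \<in> Fac x n" for u
      using d[OF that] by (intro order_less_le_trans[OF word_code_less] power_increasing) auto
    then show "(word_code \<circ> d) ` Fac x n \<subseteq> {..<2 ^ Suc ?k}" by auto
  qed simp
  then have "real (subword_complexity x n) \<le> 2 ^ Suc ?k"
    unfolding subword_complexity_def
    by (metis card_lessThan numeral_power_eq_of_nat_cancel_iff of_nat_le_iff)
  then have "log 2 (real (subword_complexity x n)) \<le> log 2 (2 ^ Suc ?k)"
    using subword_complexity_pos[of x n] by (subst log_le_cancel_iff) auto
  also have "\<dots> = real (Suc ?k)" by (subst log_nat_power) auto
  finally show ?thesis by simp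
qed


section \<open>The two entropies\<close>

theorem theorem32:
  fixes D :: "word \<rightharpoonup> word" and x :: "nat \<Rightarrow> bool"
  assumes "optimal_decompressor D"
  shows "convergent (\<lambda>n. real (max_complexity D x n) / real n) \<and>
    complexity_entropy D x = topological_entropy x"
proof -
  let ?E = "topological_entropy x"
  define a where "a = (\<lambda>n. log 2 (real (subword_complexity x n)) / real n)"
  define b where "b = (\<lambda>n. real (max_complexity D x n) / real n)"
  have a: "a \<longlonglongrightarrow> ?E"
    using convergent_topological_entropy[of x]
    unfolding a_def topological_entropy_def convergent_LIMSEQ_iff .
  have inv: "(\<lambda>n. C / real n) \<longlonglongrightarrow> 0" for C :: real
    by (rule lim_const_over_n)
  have "b \<longlonglongrightarrow> ?E"
  proof (rule order_tendstoI)
    fix l assume "l < ?E"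
    moreover have "(\<lambda>n. a n - 1 / real n) \<longlonglongrightarrow> ?E"
      using tendsto_diff[OF a inv[of 1]] by simp
    ultimately have "eventually (\<lambda>n. l < a n - 1 / real n) sequentially"
      by (rule order_tendstoD(1)[rotated])
    \<comment> \<open>This includes \<open>n = 0\<close>, where all quotients by 0 are 0.\<close>
    moreover have "a n - 1 / real n \<le> b n" for n
      using divide_right_mono[OF log_subword_complexity_le[OF assms, of x n], of "real n"]
      by (simp add: a_def b_def add_divide_distrib)
    ultimately show "eventually (\<lambda>n. l < b n) sequentially"
      by (auto elim!: eventually_mono intro: order_less_le_trans)
  next
    fix l assume "?E < l"
    moreover have "(\<lambda>m. a m + 1 / real m) \<longlonglongrightarrow> ?E"
      using tendsto_add[OF a inv[of 1]] by simp
    ultimately have "eventually (\<lambda>m. a m + 1 / real m < l) sequentially"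
      by (rule order_tendstoD(2)[rotated])
    with eventually_gt_at_top[of 0]
    have "eventually (\<lambda>m. 0 < m \<and> a m + 1 / real m < l) sequentially"
      by (rule eventually_conj)
    \<comment> \<open>From here on \<open>m\<close> is fixed and \<open>n\<close> grows; the
      constant \<open>c\<close> obtained next depends on this \<open>m\<close>.\<close>
    then obtain m where m: "m > 0" "a m + 1 / real m < l"
      using eventually_happens'[OF sequentially_bot] by blast
    obtain c where c: "\<And>n. real (max_complexity D x n) \<le>
        real c + real n / real m * (log 2 (real (subword_complexity x m)) + 1)"
      using max_complexity_le[OF assms m(1)] by blast
    have bn: "b n \<le> real c / real n + (a m + 1 / real m)" if "n > 0" for n
    proof -
      have "b n \<le> (real c + real n / real m *
          (log 2 (real (subword_complexity x m)) + 1)) / real n"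
        unfolding b_def by (intro divide_right_mono c) simp
      also have "\<dots> = real c / real n + (a m + 1 / real m)"
        using that m(1) unfolding a_def by (simp add: field_simps)
      finally show ?thesis .
    qed
    have "(\<lambda>n. real c / real n + (a m + 1 / real m)) \<longlonglongrightarrow> a m + 1 / real m"
      using tendsto_add[OF inv tendsto_const] by simp
    then have "eventually (\<lambda>n. real c / real n + (a m + 1 / real m) < l) sequentially"
      using m(2) by (rule order_tendstoD(2))
    with eventually_gt_at_top[of 0] show "eventually (\<lambda>n. b n < l) sequentially"
      by eventually_elim (use bn order_le_less_trans in blast)
  qed
  then show ?thesis
    unfolding b_def complexity_entropy_def by (auto intro: convergentI limI)
qed

end
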